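(* Let $(X,p,E)$ be a lattice-normed Riesz space, let $(x_n)$ be a monotone (increasing or decreasing) sequence in $X$, and let $x\in X$. If $(x_n)$ is statistically unbounded $p$-convergent to $x$, then $(x_n)$ is statistically $p$-convergent to $x$.
   Context: All Riesz spaces (vector lattices) are real and Archimedean; sequences are indexed by the positive integers $\mathbb{N}$; $E_+$ and $X_+$ denote positive cones. A lattice-normed Riesz space $(X,p,E)$ consists of Riesz spaces $X$ and $E$ and a map $p:X\to E_+$ with $p(x)=0\Leftrightarrow x=0$, $p(\lambda x)=|\lambda|p(x)$ for $\lambda\in\mathbb{R}$, $p(x+y)\le p(x)+p(y)$, which is monotone: $|x|\le|y|$ implies $p(x)\le p(y)$. The natural density of $K\subseteq\mathbb{N}$ is $\delta(K)=\lim_{n}\frac1n|\{k\le n:k\in K\}|$. A sequence $(q_n)$ in $E$ is statistically order decreasing to $0$, written $q_n\downarrow^{st}0$, if there is $K\subseteq\mathbb{N}$ with $\delta(K)=1$ such that $(q_k)_{k\in K}$ is decreasing and $\inf_{k\in K}q_k=0$. A sequence $(x_n)$ in $X$ is statistically $p$-convergent to $x\in X$ if there exist a sequence $q_n\downarrow^{st}0$ in $E$ and a set $K\subseteq\mathbb{N}$ with $\delta(K)=1$ such that $p(x_k-x)\le q_k$ for all $k\in K$. It is statistically unbounded $p$-convergent ($st$-$up$-convergent) to $x\in X$ if for every $u\in X_+$ there exist a sequence $q_n\downarrow^{st}0$ in $E$ and a set $K\subseteq\mathbb{N}$ with $\delta(K)=1$ such that $p(|x_k-x|\wedge u)\le q_k$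 for all $k\in K$. *)

theory Defs
  imports Complex_Main "HOL-Library.Lattice_Algebras" "HOL-Library.Lub_Glb"
begin

text \<open>
  In \<open>lattice_ab_group_add_abs\<close> the absolute value is \<open>\<bar>a\<bar> = sup a (- a)\<close>.
\<close>

class archimedean_riesz_space = ordered_real_vector + lattice_ab_group_add_abs +
  assumes archimedean: "0 \<le> a \<Longrightarrow> (\<And>n::nat. of_nat n *\<^sub>R a \<le> b) \<Longrightarrow> a = 0"

locale lattice_normed_riesz_space =
  fixes p :: "'x::archimedean_riesz_space \<Rightarrow> 'e::archimedean_riesz_space"
  assumes p_nonneg: "0 \<le> p a"
    and p_eq_0_iff: "p a = 0 \<longleftrightarrow> a = 0"
    and p_scaleR: "p (r *\<^sub>R a) = \<bar>r\<bar> *\<^sub>R p a"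
    and p_triangle: "p (a + b) \<le> p a + p b"
    and p_mono: "\<bar>a\<bar> \<le> \<bar>b\<bar> \<Longrightarrow> p a \<le> p b"

text \<open>
  Sequences are indexed by the positive integers: a sequence is a function on \<open>nat\<close> whose
  value at \<open>0\<close> is irrelevant, and all index sets are subsets of \<open>{1..}\<close>.
\<close>

definition has_natural_density :: "nat set \<Rightarrow> real \<Rightarrow> bool" where
  "has_natural_density K d \<longleftrightarrow>
     K \<subseteq> {1..} \<and> (\<lambda>n. real (card {k \<in> K. k \<le> n}) / real n) \<longlonglongrightarrow> d"

definition st_order_decreasing_0 :: "(nat \<Rightarrow> 'e::archimedean_riesz_space) \<Rightarrow> bool" where
  "st_order_decreasing_0 q \<longleftrightarrow>
     (\<exists>K. has_natural_density K 1 \<and> antimono_on K q \<and> isGlb UNIV (q ` K) 0)"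

definition st_p_convergent ::
    "('x::archimedean_riesz_space \<Rightarrow> 'e::archimedean_riesz_space) \<Rightarrow> (nat \<Rightarrow> 'x) \<Rightarrow> 'x \<Rightarrow> bool" where
  "st_p_convergent p s l \<longleftrightarrow>
     (\<exists>q K. st_order_decreasing_0 q \<and> has_natural_density K 1 \<and> (\<forall>k\<in>K. p (s k - l) \<le> q k))"

definition st_up_convergent ::
    "('x::archimedean_riesz_space \<Rightarrow> 'e::archimedean_riesz_space) \<Rightarrow> (nat \<Rightarrow> 'x) \<Rightarrow> 'x \<Rightarrow> bool" where
  "st_up_convergent p s l \<longleftrightarrow>
     (\<forall>u\<ge>0. \<exists>q K. st_order_decreasing_0 q \<and> has_natural_density K 1 \<and>
        (\<forall>k\<in>K. p (inf \<bar>s k - l\<bar> u) \<le> q k))"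

end

theory Submission
  imports Defs
begin

text \<open>
  Up to sign the sequence is increasing. Testing unbounded convergence against
  \<open>u = sup (x n - l) 0\<close> gives \<open>p u \<le> q k\<close> for all large \<open>k\<close> in a set of density one, because
  \<open>u \<le> \<bar>x k - l\<bar>\<close> for \<open>k \<ge> n\<close>; hence \<open>u = 0\<close> and \<open>x n \<le> l\<close>. So \<open>\<bar>x k - l\<bar> \<le> l - x 1\<close> for
  every \<open>k \<ge> 1\<close>, and testing against \<open>l - x 1\<close> removes the truncation.
\<close>

text \<open>By inclusion-exclusion: if \<open>K \<inter> L\<close> lay below \<open>m\<close>, the
  two counting ratios would sum to at most \<open>1 + m / n\<close>, which tends to 1, whereas their
  limits sum to 2.\<close>

lemma density_one_Int_unbounded:
  assumes K: "has_natural_density K 1" and L: "has_natural_density L 1"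
  shows "\<exists>k\<in>K \<inter> L. m \<le> k"
proof (rule ccontr)
  assume "\<not> ?thesis"
  then have sub: "K \<inter> L \<subseteq> {..<m}" by (auto simp: not_le)
  let ?c = "\<lambda>A n. real (card {k \<in> A. k \<le> n}) / real n"
  have le: "?c K n + ?c L n \<le> 1 + real m / real n" if "n \<ge> 1" for n
  proof -
    let ?K = "{k \<in> K. k \<le> n}" and ?L = "{k \<in> L. k \<le> n}"
    \<comment> \<open>Sets with a density exclude 0, so the union has at most \<open>n\<close>
      elements, not \<open>n + 1\<close>.\<close>
    have "?K \<union> ?L \<subseteq> {1..n}"
      using K L by (auto simp: has_natural_density_def)
    then have "card (?K \<union> ?L) \<le> n"
      using card_mono[of "{1..n}"] by fastforce
    moreover have "?K \<inter> ?L \<subseteq> {..<m}" using sub by auto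
    then have "card (?K \<inter> ?L) \<le> m"
      using card_mono[of "{..<m}"] by fastforce
    moreover have "card ?K + card ?L = card (?K \<union> ?L) + card (?K \<inter> ?L)"
      by (rule card_Un_Int) simp_all
    ultimately have "card ?K + card ?L \<le> n + m" by linarith
    then have "real (card ?K) + real (card ?L) \<le> real n + real m"
      by (metis of_nat_add of_nat_mono)
    then have "(real (card ?K) + real (card ?L)) / real n \<le> (real n + real m) / real n"
      by (rule divide_right_mono) simp
    with that show ?thesis
      by (simp add: add_divide_distrib)
  qed
  have "(\<lambda>n. ?c K n + ?c L n) \<longlonglongrightarrow> 1 + 1"
    using K L unfolding has_natural_density_def by (intro tendsto_add) auto
  moreover have "(\<lambda>n. 1 + real m / real n) \<longlonglongrightarrow> 1 + 0"
    by (intro tendsto_add tendsto_const lim_const_over_n)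
  ultimately have "(1 + 1 :: real) \<le> 1 + 0"
    by (rule LIMSEQ_le) (use le in blast)
  then show False by simp
qed

text \<open>The bound holds only on a tail of \<open>K\<close>, while \<open>q\<close> decreases
  only along its own set \<open>L\<close>. Common indices carry the bound over to all of
  \<open>L\<close>, making \<open>y\<close> a lower bound of \<open>q\<close> there.\<close>

lemma le_0_if_le_st_order_decreasing_0:
  assumes q: "st_order_decreasing_0 q" and K: "has_natural_density K 1"
    and le: "\<And>k. k \<in> K \<Longrightarrow> n \<le> k \<Longrightarrow> y \<le> q k"
  shows "y \<le> 0"
proof -
  obtain L where L: "has_natural_density L 1" "antimono_on L q" "isGlb UNIV (q ` L) 0"
    using q unfolding st_order_decreasing_0_def by blast
  have "y \<le> q m" if "m \<in> L" for m
  proof -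
    \<comment> \<open>Being beyond \<open>n\<close> gives \<open>y \<le> q k\<close>; being beyond
      \<open>m\<close> inside \<open>L\<close> gives \<open>q k \<le> q m\<close>.\<close>
    obtain k where "k \<in> K" "k \<in> L" "max m n \<le> k"
      using density_one_Int_unbounded[OF K L(1)] by blast
    then have "y \<le> q k" "q k \<le> q m"
      using le that L(2) by (auto simp: monotone_on_def)
    then show ?thesis by (rule order_trans)
  qed
  then have "isLb UNIV (q ` L) y"
    by (auto simp: isLb_def setge_def)
  with L(3) show ?thesis
    by (rule isGlb_le_isLb)
qed

context lattice_normed_riesz_space
begin

lemma p_abs [simp]: "p \<bar>a\<bar> = p a"
  by (intro antisym p_mono) simp_all

lemma increasing_st_up_convergent_le:
  assumes mono: "mono_on {1..} x" and conv: "st_up_convergent p x l" and n: "n \<ge> 1"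
  shows "x n \<le> l"
proof -
  define u where "u = sup (x n - l) 0"
  have u: "u \<ge> 0" by (simp add: u_def)
  then obtain q K where q: "st_order_decreasing_0 q" and K: "has_natural_density K 1"
    and le: "\<And>k. k \<in> K \<Longrightarrow> p (inf \<bar>x k - l\<bar> u) \<le> q k"
    using conv unfolding st_up_convergent_def by blast
  have "p u \<le> q k" if "k \<in> K" "n \<le> k" for k
  proof -
    have "x n \<le> x k"
      using mono n that(2) by (auto simp: monotone_on_def)
    then have "x n - l \<le> \<bar>x k - l\<bar>"
      by (meson abs_ge_self diff_right_mono order_trans)
    \<comment> \<open>An absolute value is also above 0, hence above the positive part
      \<open>u\<close>.\<close>
    then have "u \<le> \<bar>x k - l\<bar>" by (simp add: u_def)
    then show ?thesis using le[OF that(1)] by (simp add: inf_absorb2)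
  qed
  then have "p u \<le> 0"
    by (rule le_0_if_le_st_order_decreasing_0[OF q K])
  then have "u = 0" by (metis antisym p_nonneg p_eq_0_iff)
  then have "x n - l \<le> 0" unfolding u_def by (metis sup_ge1)
  then show ?thesis by simp
qed

lemma increasing_st_up_convergent_imp_st_p_convergent:
  assumes mono: "mono_on {1..} x" and conv: "st_up_convergent p x l"
  shows "st_p_convergent p x l"
proof -
  have "0 \<le> l - x 1"
    using increasing_st_up_convergent_le[OF mono conv, of 1] by simp
  then obtain q K where q: "st_order_decreasing_0 q" and K: "has_natural_density K 1"
    and le: "\<And>k. k \<in> K \<Longrightarrow> p (inf \<bar>x k - l\<bar> (l - x 1)) \<le> q k"
    using conv unfolding st_up_convergent_def by blast
  have "p (x k - l) \<le> q k" if "k \<in> K" for k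
  proof -
    have "k \<ge> 1" using K that by (auto simp: has_natural_density_def)
    then have "x 1 \<le> x k" "x k \<le> l"
      using mono increasing_st_up_convergent_le[OF mono conv]
      by (auto simp: monotone_on_def)
    \<comment> \<open>Since \<open>x k \<le> l\<close>, the left side equals
      \<open>l - x k\<close>.\<close>
    then have "\<bar>x k - l\<bar> \<le> l - x 1"
      by (simp add: abs_minus_commute[of "x k"])
    then show ?thesis
      using le[OF that] by (simp add: inf_absorb1)
  qed
  with q K show ?thesis
    unfolding st_p_convergent_def by blast
qed

lemma p_uminus [simp]: "p (- a) = p a"
  by (metis p_abs abs_minus_cancel)

text \<open>Negating sequence and limit leaves \<open>\<bar>x k - l\<bar>\<close> unchanged.
  Together with its analogue for \<open>st_p_convergent\<close>, this reduces the decreasing case to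
  the increasing one.\<close>

lemma st_up_convergent_uminus:
  "st_up_convergent p (\<lambda>n. - x n) (- l) \<longleftrightarrow> st_up_convergent p x l"
  by (simp add: st_up_convergent_def abs_minus_commute)

lemma st_p_convergent_uminus:
  "st_p_convergent p (\<lambda>n. - x n) (- l) \<longleftrightarrow> st_p_convergent p x l"
proof -
  have "p (- x k - - l) = p (x k - l)" for k
    using p_uminus[of "x k - l"] by simp
  then show ?thesis by (simp only: st_p_convergent_def)
qed

end

theorem theorem3p12:
  fixes p :: "'x::archimedean_riesz_space \<Rightarrow> 'e::archimedean_riesz_space"
    and x :: "nat \<Rightarrow> 'x"
    and l :: 'x
  assumes "lattice_normed_riesz_space p"
    and "mono_on {1..} x \<or> antimono_on {1..} x"
    and "st_up_convergent p x l"
  shows "st_p_convergent p x l"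
proof -
  interpret lattice_normed_riesz_space p by (rule assms(1))
  from assms(2) show ?thesis
  proof
    assume "mono_on {1..} x"
    then show ?thesis
      using assms(3) by (rule increasing_st_up_convergent_imp_st_p_convergent)
  next
    assume "antimono_on {1..} x"
    then have "mono_on {1..} (\<lambda>n. - x n)"
      by (simp add: monotone_on_def)
    moreover have "st_up_convergent p (\<lambda>n. - x n) (- l)"
      using assms(3) by (simp only: st_up_convergent_uminus)
    ultimately have "st_p_convergent p (\<lambda>n. - x n) (- l)"
      by (rule increasing_st_up_convergent_imp_st_p_convergent)
    then show ?thesis by (simp only: st_p_convergent_uminus)
  qed
qed

end
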